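(* Let $\mathcal{H}$ be a real Hilbert space. Let $\alpha\in(0,1]$, let $\lambda_k\in(0,\tfrac1\alpha]$ for every $k\in\mathbb{N}$, let $T:\mathcal{H}\to\mathcal{H}$ be $\alpha$-averaged with $\operatorname{Fix}T\neq\varnothing$, and let $T_k:\mathcal{H}\to\mathcal{H}$ for every $k\in\mathbb{N}$. Let $(e_k)_{k\in\mathbb{N}}$ be a sequence in $\mathcal{H}$ and let $(\eta_k)_{k\in\mathbb{N}}$ be in $\mathbb{R}_+$ such that $\sum_{k\in\mathbb{N}}\eta_k\|e_k\|<\infty$. Let $x_0\in\mathcal{H}$ and define $$(\forall k\in\mathbb{N})\quad x_{k+1}=(1-\lambda_k)x_k+\lambda_kT_kx_k+\eta_ke_k .$$ Suppose that $\sum_{k\in\mathbb{N}}\lambda_k\|T_kx_k-Tx_k\|<\infty$. Then the following hold. (i) Define $$(\forall i\in\mathbb{N})(\forall k\in\mathbb{N})\quad \xi_{k+1}(i)=(1-\lambda_{k+i})\xi_k(i)+\lambda_{k+i}T\xi_k(i)\quad\text{and}\quad \xi_0(i)=x_i .$$ Suppose that for every $i\in\mathbb{N}$ the sequence $(\xi_k(i))_{k\in\mathbb{N}}$ converges weakly to a point $\xi(i)\in\mathcal{H}$. Then: (a) there exists a point $\bar\xi\in\mathcal{H}$ such that $(\xi(i))_{i\in\mathbb{N}}$ converges strongly to $\bar\xi$; (b) $(x_k)_{k\in\mathbb{N}}$ converges weakly to $\bar\xi=\lim_{i\to\infty}\xi(i)$; (c) if, further, for every $i\in\mathbb{N}$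 the sequence $(\xi_k(i))_{k\in\mathbb{N}}$ converges strongly to a point $\xi(i)\in\mathcal{H}$, then $(x_k)_{k\in\mathbb{N}}$ converges strongly to $\bar\xi=\lim_{i\to\infty}\xi(i)$. (ii) Suppose that $\sum_{k\in\mathbb{N}}\lambda_k\left(\tfrac1\alpha-\lambda_k\right)=\infty$. Then $(x_k)_{k\in\mathbb{N}}$ converges weakly to a point $\bar x$ in $\operatorname{Fix}T$.
   Context: $\mathbb{N}=\{0,1,2,\ldots\}$, $\mathbb{R}_+=[0,\infty)$. An operator $R:\mathcal{H}\to\mathcal{H}$ is nonexpansive if $\|Rx-Ry\|\le\|x-y\|$ for all $x,y$. For $\alpha\in(0,1]$, $T:\mathcal{H}\to\mathcal{H}$ is $\alpha$-averaged if there is a nonexpansive operator $R:\mathcal{H}\to\mathcal{H}$ with $T=(1-\alpha)\operatorname{Id}+\alpha R$ (so $1$-averaged means nonexpansive). $\operatorname{Fix}T=\{x\in\mathcal{H}:Tx=x\}$. Strong convergence means convergence in norm. *)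

theory Defs
  imports "HOL-Analysis.Analysis"
begin

definition nonexpansive :: "('a::real_normed_vector \<Rightarrow> 'a) \<Rightarrow> bool" where
  "nonexpansive R \<longleftrightarrow> (\<forall>x y. norm (R x - R y) \<le> norm (x - y))"

text \<open>Meaningful only for \<open>0 < \<alpha> \<le> 1\<close>; the range is not part of the definition.\<close>

definition averaged :: "real \<Rightarrow> ('a::real_normed_vector \<Rightarrow> 'a) \<Rightarrow> bool" where
  "averaged \<alpha> T \<longleftrightarrow>
    (\<exists>R. nonexpansive R \<and> (\<forall>x. T x = (1 - \<alpha>) *\<^sub>R x + \<alpha> *\<^sub>R R x))"

definition Fix :: "('a \<Rightarrow> 'a) \<Rightarrow> 'a set" where
  "Fix T = {x. T x = x}"

text \<open>
  The weak topology of a Hilbert space is the coarsest one making all the functionals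
  \<open>\<lambda>y. y \<bullet> u\<close> continuous; by Riesz representation these are all the bounded linear functionals.
\<close>

definition weakly_converges :: "(nat \<Rightarrow> 'a::real_inner) \<Rightarrow> 'a \<Rightarrow> bool" where
  "weakly_converges s l \<longleftrightarrow> (\<forall>u. (\<lambda>k. s k \<bullet> u) \<longlonglongrightarrow> l \<bullet> u)"

end

theory Submission
  imports Defs
begin

text \<open>
  The averaged operator is \<open>T = (1 - \<alpha>) Id + \<alpha> R\<close> with \<open>R\<close> nonexpansive, so each step map
  \<open>U\<^sub>k = (1 - \<lambda>\<^sub>k) Id + \<lambda>\<^sub>k T = (1 - \<alpha> \<lambda>\<^sub>k) Id + \<alpha> \<lambda>\<^sub>k R\<close> is nonexpansive, because
  \<open>\<alpha> \<lambda>\<^sub>k \<in> [0, 1]\<close>.  The sequence \<open>x\<close> follows the maps \<open>U\<^sub>k\<close> up to errors whose norms have a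
  finite sum.

  Part (i) rests on one estimate.  Let \<open>\<tau>\<^sub>i\<close> be the sum of the errors from time \<open>i\<close> on.  Since
  nonexpansive maps never amplify an error, \<open>x\<close> stays within \<open>\<tau>\<^sub>i\<close> of the exact orbit that starts
  at \<open>x\<^sub>i\<close> (\<open>inexact_orbit_near_exact\<close>).  Hence the limits \<open>\<xi>\<^sub>i\<close> and \<open>\<xi>\<^sub>j\<close> are within \<open>\<tau>\<^sub>i\<close> of each
  other for \<open>j \<ge> i\<close>, closed balls being weakly closed; so \<open>\<xi>\<close> is Cauchy, and \<open>x\<close> inherits the kind of
  convergence that the exact orbits have, with an additional deviation \<open>2 \<tau>\<^sub>i \<rightarrow> 0\<close>
  (\<open>inexact_orbit_limit\<close>).

  For part (ii) it then suffices that every exact orbit converges weakly to a fixed point: the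
  strong limit of these fixed points is again one.  For an exact orbit \<open>y\<close> the divergence
  hypothesis forces \<open>y\<^sub>k - R y\<^sub>k \<rightarrow> 0\<close> (\<open>averaged_orbit_regular\<close>), and the distance from \<open>y\<^sub>k\<close> to
  any fixed point decreases.  The usual next step extracts weakly convergent subsequences.  Here
  asymptotic centres replace weak compactness, and only norm completeness is used: a bounded
  family has a unique point \<open>a\<close> from which its eventual distance is least (\<open>asymptotic_centre_exists\<close>,
  \<open>asymptotic_centre_unique\<close>), and this point is fixed by \<open>R\<close> because \<open>R\<close> does not increase the
  eventual distance.  Monotonicity of the distances to fixed points makes \<open>a\<close> the centre of every
  subsequence too.  But a centre cannot have the whole family on one side of it with a fixed margin,
  since moving it to that side would bring it closer; therefore \<open>y\<^sub>k\<close> converges weakly to \<open>a\<close>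
  (\<open>Fejer_weak_convergence\<close>).
\<close>

section \<open>Asymptotic centres in Hilbert space\<close>

text \<open>
  The family is given as a filter, so that a sequence and all its subsequences are treated alike:
  passing to a subsequence means passing to a finer filter.
\<close>

definition asymptotic_radius :: "'a::real_normed_vector filter \<Rightarrow> real" where
  "asymptotic_radius F = Inf {\<rho>. \<exists>w. \<forall>\<^sub>F p in F. norm (p - w) \<le> \<rho>}"

text \<open>
  The strict inequality expresses \<open>limsup norm (p - v) \<le> asymptotic_radius F\<close> without forming a
  limes superior.
\<close>

definition asymptotic_centre :: "'a::real_normed_vector filter \<Rightarrow> 'a \<Rightarrow> bool" where
  "asymptotic_centre F v \<longleftrightarrow> (\<forall>\<rho> > asymptotic_radius F. \<forall>\<^sub>F p in F. norm (p - v) \<le> \<rho>)"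

lemma eventual_bound_nonneg:
  assumes "F \<noteq> bot" and "\<forall>\<^sub>F p in F. norm (p - w) \<le> \<rho>"
  shows "0 \<le> \<rho>"
proof -
  obtain p where "norm (p - w) \<le> \<rho>"
    using eventually_happens'[OF assms] by blast
  then show ?thesis using norm_ge_zero order_trans by blast
qed

lemma asymptotic_radius_le:
  assumes "F \<noteq> bot" and "\<forall>\<^sub>F p in F. norm (p - w) \<le> \<rho>"
  shows "asymptotic_radius F \<le> \<rho>"
  unfolding asymptotic_radius_def
proof (rule cInf_lower)
  show "\<rho> \<in> {\<rho>. \<exists>w. \<forall>\<^sub>F p in F. norm (p - w) \<le> \<rho>}" using assms(2) by blast
  show "bdd_below {\<rho>. \<exists>w. \<forall>\<^sub>F p in F. norm (p - w) \<le> \<rho>}"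
    using eventual_bound_nonneg[OF assms(1)] by (auto intro!: bdd_belowI[of _ 0])
qed

lemma asymptotic_radius_nonneg:
  assumes "F \<noteq> bot" and "\<forall>\<^sub>F p in F. norm (p - w) \<le> B"
  shows "0 \<le> asymptotic_radius F"
  unfolding asymptotic_radius_def
  using assms eventual_bound_nonneg[OF assms(1)] by (auto intro!: cInf_greatest)

lemma asymptotic_radius_approx:
  assumes "\<forall>\<^sub>F p in F. norm (p - w) \<le> B" and "asymptotic_radius F < \<rho>"
  shows "\<exists>v. \<forall>\<^sub>F p in F. norm (p - v) \<le> \<rho>"
proof -
  have "{\<rho>. \<exists>w. \<forall>\<^sub>F p in F. norm (p - w) \<le> \<rho>} \<noteq> {}" using assms(1) by blast
  from cInf_lessD[OF this assms(2)[unfolded asymptotic_radius_def]]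
  obtain \<sigma> v where "\<sigma> < \<rho>" and v: "\<forall>\<^sub>F p in F. norm (p - v) \<le> \<sigma>" by fast
  from v have "\<forall>\<^sub>F p in F. norm (p - v) \<le> \<rho>"
    by eventually_elim (use \<open>\<sigma> < \<rho>\<close> in linarith)
  then show ?thesis ..
qed

lemma median_identity:
  fixes p v w :: "'a::real_inner"
  shows "(norm (p - (1/2) *\<^sub>R (v + w)))\<^sup>2
    = (norm (p - v))\<^sup>2 / 2 + (norm (p - w))\<^sup>2 / 2 - (norm (v - w))\<^sup>2 / 4"
  by (simp add: power2_norm_eq_inner inner_diff_left inner_diff_right inner_add_left
      inner_add_right inner_commute field_simps)

text \<open>
  Two points that are both almost as good as possible are close: their midpoint would otherwise
  beat the radius.
\<close>

lemma near_centres_close: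
  fixes v w :: "'a::real_inner"
  assumes "F \<noteq> bot"
    and v: "\<forall>\<^sub>F p in F. norm (p - v) \<le> \<rho>" and w: "\<forall>\<^sub>F p in F. norm (p - w) \<le> \<rho>"
  shows "(norm (v - w))\<^sup>2 \<le> 4 * (\<rho>\<^sup>2 - (asymptotic_radius F)\<^sup>2)"
proof -
  let ?q = "\<rho>\<^sup>2 - (norm (v - w))\<^sup>2 / 4" and ?m = "(1/2) *\<^sub>R (v + w)"
  have mid: "(norm (p - ?m))\<^sup>2 \<le> ?q" if "norm (p - v) \<le> \<rho>" "norm (p - w) \<le> \<rho>" for p
  proof -
    have "(norm (p - v))\<^sup>2 \<le> \<rho>\<^sup>2" "(norm (p - w))\<^sup>2 \<le> \<rho>\<^sup>2"
      using that by (simp_all add: power_mono)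
    then show ?thesis unfolding median_identity by simp
  qed
  have "\<forall>\<^sub>F p in F. (norm (p - ?m))\<^sup>2 \<le> ?q"
    using v w by eventually_elim (rule mid)
  then have ev: "\<forall>\<^sub>F p in F. norm (p - ?m) \<le> sqrt ?q"
    by eventually_elim (simp add: real_le_rsqrt)
  have "asymptotic_radius F \<le> sqrt ?q"
    using asymptotic_radius_le[OF assms(1) ev] .
  moreover have "0 \<le> asymptotic_radius F"
    using asymptotic_radius_nonneg[OF assms(1) v] .
  moreover have "0 \<le> ?q"
    using eventual_bound_nonneg[OF assms(1) ev] by simp
  ultimately have "(asymptotic_radius F)\<^sup>2 \<le> ?q"
    by (metis power_mono real_sqrt_pow2)
  then show ?thesis by simp
qed

lemma asymptotic_centre_unique:
  fixes v w :: "'a::real_inner"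
  assumes "F \<noteq> bot" and "asymptotic_centre F v" and "asymptotic_centre F w"
  shows "v = w"
proof -
  let ?r = "asymptotic_radius F"
  have "(norm (v - w))\<^sup>2 \<le> 4 * (\<rho>\<^sup>2 - ?r\<^sup>2)" if "\<rho> > ?r" for \<rho>
    using that assms near_centres_close unfolding asymptotic_centre_def by blast
  then have "\<forall>\<^sub>F \<rho> in at_right ?r. (norm (v - w))\<^sup>2 \<le> 4 * (\<rho>\<^sup>2 - ?r\<^sup>2)"
    by (auto simp: eventually_at_filter)
  moreover have "((\<lambda>\<rho>. 4 * (\<rho>\<^sup>2 - ?r\<^sup>2)) \<longlongrightarrow> 4 * (?r\<^sup>2 - ?r\<^sup>2)) (at_right ?r)"
    by (intro tendsto_intros)
  ultimately have "(norm (v - w))\<^sup>2 \<le> 4 * (?r\<^sup>2 - ?r\<^sup>2)"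
    using tendsto_lowerbound trivial_limit_at_right_real by blast
  then show ?thesis by simp
qed

text \<open>
  Near-optimal points for radii shrinking to the asymptotic radius form a Cauchy sequence by
  \<open>near_centres_close\<close>, and their limit is a centre.
\<close>

lemma asymptotic_centre_exists:
  fixes F :: "'a::{real_inner, complete_space} filter"
  assumes "F \<noteq> bot" and bdd: "\<forall>\<^sub>F p in F. norm (p - w) \<le> B"
  shows "\<exists>v. asymptotic_centre F v"
proof -
  let ?r = "asymptotic_radius F"
  define \<rho> where "\<rho> n = ?r + 1 / real (Suc n)" for n
  have "\<exists>v. \<forall>\<^sub>F p in F. norm (p - v) \<le> \<rho> n" for n
    by (rule asymptotic_radius_approx[OF bdd]) (simp add: \<rho>_def)
  then obtain v where v: "\<And>n. \<forall>\<^sub>F p in F. norm (p - v n) \<le> \<rho> n" by metis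
  have \<rho>_lim: "\<rho> \<longlonglongrightarrow> ?r"
    unfolding \<rho>_def using tendsto_add[OF tendsto_const LIMSEQ_inverse_real_of_nat, of ?r]
    by (simp add: inverse_eq_divide)
  have later: "\<forall>\<^sub>F p in F. norm (p - v n) \<le> \<rho> N" if "N \<le> n" for n N
  proof -
    have "\<rho> n \<le> \<rho> N" using that by (simp add: \<rho>_def frac_le)
    then show ?thesis using v[of n] by (auto elim!: eventually_mono)
  qed
  have close: "(norm (v m - v n))\<^sup>2 \<le> 4 * ((\<rho> N)\<^sup>2 - ?r\<^sup>2)" if "N \<le> m" "N \<le> n" for m n N
    using near_centres_close[OF assms(1) later later] that by blast
  have gap: "(\<lambda>N. 4 * ((\<rho> N)\<^sup>2 - ?r\<^sup>2)) \<longlonglongrightarrow> 0"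
    using tendsto_mult_left[OF tendsto_diff[OF tendsto_power[OF \<rho>_lim, of 2] tendsto_const, of "?r\<^sup>2"], of 4]
    by simp
  have "Cauchy v"
  proof (rule CauchyI)
    fix \<epsilon> :: real assume "0 < \<epsilon>"
    then have "\<forall>\<^sub>F N in sequentially. 4 * ((\<rho> N)\<^sup>2 - ?r\<^sup>2) < \<epsilon>\<^sup>2"
      by (intro order_tendstoD(2)[OF gap]) simp
    then obtain N where N: "4 * ((\<rho> N)\<^sup>2 - ?r\<^sup>2) < \<epsilon>\<^sup>2"
      using eventually_happens' sequentially_bot by blast
    have "norm (v m - v n) < \<epsilon>" if "N \<le> m" "N \<le> n" for m n
    proof (rule power2_less_imp_less)
      show "(norm (v m - v n))\<^sup>2 < \<epsilon>\<^sup>2" using close[OF that] N by linarith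
    qed (use \<open>0 < \<epsilon>\<close> in simp)
    then show "\<exists>M. \<forall>m\<ge>M. \<forall>n\<ge>M. norm (v m - v n) < \<epsilon>" by blast
  qed
  then obtain c where c: "v \<longlonglongrightarrow> c" using Cauchy_convergent convergent_def by blast
  have "asymptotic_centre F c"
    unfolding asymptotic_centre_def
  proof (intro allI impI)
    fix \<sigma> assume "?r < \<sigma>"
    have "(\<lambda>n. \<rho> n + norm (v n - c)) \<longlonglongrightarrow> ?r + 0"
      using c by (intro tendsto_add \<rho>_lim) (simp add: LIM_zero tendsto_norm_zero)
    from order_tendstoD(2)[OF this, of \<sigma>] \<open>?r < \<sigma>\<close>
    obtain n where n: "\<rho> n + norm (v n - c) < \<sigma>"
      using eventually_happens' sequentially_bot by force
    show "\<forall>\<^sub>F p in F. norm (p - c) \<le> \<sigma>"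
      using v[of n]
    proof eventually_elim
      case (elim p)
      then show ?case using n norm_triangle_ineq[of "p - v n" "v n - c"] by simp
    qed
  qed
  then show ?thesis ..
qed

text \<open>
  Along the family \<open>R\<close> moves points by an amount tending to zero, so \<open>R v\<close> serves as well as a
  centre \<open>v\<close>; uniqueness of the centre gives \<open>R v = v\<close>.
\<close>

lemma asymptotic_centre_fixed:
  fixes R :: "'a::real_inner \<Rightarrow> 'a"
  assumes "F \<noteq> bot" and R: "nonexpansive R"
    and reg: "\<And>\<delta>. \<delta> > 0 \<Longrightarrow> \<forall>\<^sub>F p in F. norm (p - R p) \<le> \<delta>"
    and v: "asymptotic_centre F v"
  shows "R v = v"
proof (rule asymptotic_centre_unique[OF assms(1) _ v])
  show "asymptotic_centre F (R v)"
    unfolding asymptotic_centre_def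
  proof (intro allI impI)
    fix \<rho> assume \<rho>: "asymptotic_radius F < \<rho>"
    define \<delta> where "\<delta> = (\<rho> - asymptotic_radius F) / 2"
    have "\<delta> > 0" "asymptotic_radius F < \<rho> - \<delta>" using \<rho> by (simp_all add: \<delta>_def field_simps)
    then have "\<forall>\<^sub>F p in F. norm (p - v) \<le> \<rho> - \<delta>"
      using v unfolding asymptotic_centre_def by blast
    then show "\<forall>\<^sub>F p in F. norm (p - R v) \<le> \<rho>"
      using reg[OF \<open>\<delta> > 0\<close>]
    proof eventually_elim
      case (elim p)
      have "norm (R p - R v) \<le> norm (p - v)" using R by (simp add: nonexpansive_def)
      then show ?case using elim norm_triangle_ineq[of "p - R p" "R p - R v"] by simp
    qed
  qed
qed

text \<open>
  If the whole family had \<open>(p - a) \<bullet> u \<ge> \<epsilon>\<close>, then moving from \<open>a\<close> by a small multiple of \<open>u\<close> would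
  lower all squared distances by a fixed amount.
\<close>

lemma asymptotic_centre_not_one_sided:
  fixes a u :: "'a::real_inner"
  assumes "F \<noteq> bot" and a: "asymptotic_centre F a" and "\<epsilon> > 0"
  shows "\<not> (\<forall>\<^sub>F p in F. (p - a) \<bullet> u \<ge> \<epsilon>)"
proof
  assume side: "\<forall>\<^sub>F p in F. (p - a) \<bullet> u \<ge> \<epsilon>"
  let ?r = "asymptotic_radius F"
  \<comment> \<open>the step length is chosen so that \<open>2 t \<epsilon> - t\<^sup>2 norm u\<^sup>2\<close> is positive\<close>
  define t where "t = \<epsilon> / ((norm u)\<^sup>2 + 1)"
  have "t > 0" using \<open>\<epsilon> > 0\<close> by (simp add: t_def add_nonneg_pos)
  have "t * (norm u)\<^sup>2 \<le> \<epsilon>"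
    using \<open>\<epsilon> > 0\<close> by (simp add: t_def divide_le_eq add_nonneg_pos)
  then have "t * (t * (norm u)\<^sup>2) \<le> t * \<epsilon>" using \<open>t > 0\<close> by simp
  have closer: "(norm (p - (a + t *\<^sub>R u)))\<^sup>2 \<le> \<rho>\<^sup>2 - t * \<epsilon>"
    if "norm (p - a) \<le> \<rho>" "(p - a) \<bullet> u \<ge> \<epsilon>" for p \<rho>
  proof -
    have "(norm (p - (a + t *\<^sub>R u)))\<^sup>2
        = (norm (p - a))\<^sup>2 - 2 * (t * ((p - a) \<bullet> u)) + t * (t * (norm u)\<^sup>2)"
      by (simp add: power2_norm_eq_inner inner_diff_left inner_diff_right inner_add_left
          inner_add_right inner_commute algebra_simps)
    moreover have "(norm (p - a))\<^sup>2 \<le> \<rho>\<^sup>2" using that(1) by (simp add: power_mono)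
    moreover have "t * \<epsilon> \<le> t * ((p - a) \<bullet> u)" using that(2) \<open>t > 0\<close> by simp
    ultimately show ?thesis using \<open>t * (t * (norm u)\<^sup>2) \<le> t * \<epsilon>\<close> by linarith
  qed
  have gain: "?r\<^sup>2 \<le> \<rho>\<^sup>2 - t * \<epsilon>" if "\<rho> > ?r" for \<rho>
  proof -
    have ev\<rho>: "\<forall>\<^sub>F p in F. norm (p - a) \<le> \<rho>"
      using a that unfolding asymptotic_centre_def by blast
    then have "\<forall>\<^sub>F p in F. (norm (p - (a + t *\<^sub>R u)))\<^sup>2 \<le> \<rho>\<^sup>2 - t * \<epsilon>"
      using side by eventually_elim (rule closer)
    then have ev: "\<forall>\<^sub>F p in F. norm (p - (a + t *\<^sub>R u)) \<le> sqrt (\<rho>\<^sup>2 - t * \<epsilon>)"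
      by eventually_elim (simp add: real_le_rsqrt)
    have "?r \<le> sqrt (\<rho>\<^sup>2 - t * \<epsilon>)" using asymptotic_radius_le[OF assms(1) ev] .
    moreover have "0 \<le> ?r" using asymptotic_radius_nonneg[OF assms(1) ev\<rho>] .
    moreover have "0 \<le> \<rho>\<^sup>2 - t * \<epsilon>" using eventual_bound_nonneg[OF assms(1) ev] by simp
    ultimately show ?thesis by (metis power_mono real_sqrt_pow2)
  qed
  have "((\<lambda>\<rho>. \<rho>\<^sup>2 - t * \<epsilon>) \<longlongrightarrow> ?r\<^sup>2 - t * \<epsilon>) (at_right ?r)" by (intro tendsto_intros)
  moreover have "\<forall>\<^sub>F \<rho> in at_right ?r. ?r\<^sup>2 \<le> \<rho>\<^sup>2 - t * \<epsilon>"
    using gain by (auto simp: eventually_at_filter)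
  ultimately have "?r\<^sup>2 \<le> ?r\<^sup>2 - t * \<epsilon>"
    using tendsto_lowerbound trivial_limit_at_right_real by blast
  then show False using mult_pos_pos[OF \<open>t > 0\<close> \<open>\<epsilon> > 0\<close>] by linarith
qed

section \<open>Weak convergence to fixed points\<close>

text \<open>
  The centre \<open>a\<close> of the sequence lies in \<open>Fix R\<close>.  If infinitely many terms satisfied
  \<open>(y\<^sub>k - a) \<bullet> u \<ge> \<epsilon>\<close>, these would have a centre \<open>v \<in> Fix R\<close> of their own.  Distances to \<open>v\<close> decrease
  along the full sequence, so the full sequence has no larger radius than the selected terms;
  hence \<open>a\<close> is their centre as well, which \<open>asymptotic_centre_not_one_sided\<close> forbids.
\<close>

lemma Fejer_weak_convergence:
  fixes y :: "nat \<Rightarrow> 'a::{real_inner, complete_space}"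
  assumes R: "nonexpansive R" and "Fix R \<noteq> {}"
    and Fejer: "\<And>z k. z \<in> Fix R \<Longrightarrow> norm (y (Suc k) - z) \<le> norm (y k - z)"
    and reg: "(\<lambda>k. norm (y k - R (y k))) \<longlonglongrightarrow> 0"
  shows "\<exists>a \<in> Fix R. weakly_converges y a"
proof -
  let ?F = "filtermap y sequentially"
  have F: "?F \<noteq> bot" by (simp add: filtermap_bot_iff)
  have mono: "norm (y n - z) \<le> norm (y k - z)" if "k \<le> n" "z \<in> Fix R" for k n z
    using that(1) by (rule lift_Suc_antimono_le[rotated]) (rule Fejer[OF that(2)])
  obtain z where z: "z \<in> Fix R" using assms(2) by blast
  have bdd: "\<forall>\<^sub>F p in ?F. norm (p - z) \<le> norm (y 0 - z)"
    using mono[OF _ z] by (auto simp: eventually_filtermap)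
  have small: "\<forall>\<^sub>F p in ?F. norm (p - R p) \<le> \<delta>" if "\<delta> > 0" for \<delta>
    using order_tendstoD(2)[OF reg that] by (auto simp: eventually_filtermap elim: eventually_mono)
  have centre: "\<exists>v \<in> Fix R. asymptotic_centre G v" if le: "G \<le> ?F" and G: "G \<noteq> bot" for G
  proof -
    obtain v where v: "asymptotic_centre G v"
      using asymptotic_centre_exists[OF G filter_leD[OF le bdd]] by blast
    moreover have "R v = v"
      using small filter_leD[OF le] by (intro asymptotic_centre_fixed[OF G R _ v]) blast
    ultimately show ?thesis unfolding Fix_def by blast
  qed
  obtain a where a: "a \<in> Fix R" "asymptotic_centre ?F a" using centre[OF order_refl F] by blast
  have one_side: "\<forall>\<^sub>F k in sequentially. (y k - a) \<bullet> u < \<epsilon>" if "\<epsilon> > 0" for u \<epsilon>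
  proof (rule ccontr)
    assume neg: "\<not> ?thesis"
    define S where "S = {p. (p - a) \<bullet> u \<ge> \<epsilon>}"
    define G where "G = inf ?F (principal S)"
    have le: "G \<le> ?F" by (simp add: G_def)
    have "\<not> (\<forall>\<^sub>F p in ?F. p \<notin> S)" using neg by (simp add: S_def eventually_filtermap not_le)
    then have G: "G \<noteq> bot"
      by (simp add: G_def trivial_limit_def eventually_inf_principal)
    obtain v where v: "v \<in> Fix R" "asymptotic_centre G v" using centre[OF le G] by blast
    have radius: "asymptotic_radius ?F \<le> \<rho>" if "\<rho> > asymptotic_radius G" for \<rho>
    proof -
      have "\<forall>\<^sub>F p in G. norm (p - v) \<le> \<rho>" using v(2) that unfolding asymptotic_centre_def by blast
      moreover have "\<forall>\<^sub>F p in G. p \<in> range y"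
        by (rule filter_leD[OF le]) (simp add: eventually_filtermap)
      ultimately obtain k where k: "norm (y k - v) \<le> \<rho>"
        using eventually_happens'[OF G eventually_conj] by blast
      have "\<forall>\<^sub>F p in ?F. norm (p - v) \<le> \<rho>"
        unfolding eventually_filtermap
        using eventually_ge_at_top[of k]
      proof eventually_elim
        case (elim n)
        then show ?case using k mono[OF elim v(1)] by linarith
      qed
      then show ?thesis by (rule asymptotic_radius_le[OF F])
    qed
    have "asymptotic_centre G a"
      unfolding asymptotic_centre_def
    proof (intro allI impI)
      fix \<rho> assume "asymptotic_radius G < \<rho>"
      then obtain \<sigma> where "asymptotic_radius G < \<sigma>" "\<sigma> < \<rho>" using dense by blast
      with radius[of \<sigma>] have "asymptotic_radius ?F < \<rho>" by linarith
      then have "\<forall>\<^sub>F p in ?F. norm (p - a) \<le> \<rho>"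
        using a(2) unfolding asymptotic_centre_def by blast
      then show "\<forall>\<^sub>F p in G. norm (p - a) \<le> \<rho>" by (rule filter_leD[OF le])
    qed
    moreover have "\<forall>\<^sub>F p in G. (p - a) \<bullet> u \<ge> \<epsilon>"
      by (simp add: G_def S_def eventually_inf_principal)
    ultimately show False using asymptotic_centre_not_one_sided[OF G _ that] by blast
  qed
  have "(\<lambda>k. y k \<bullet> u) \<longlonglongrightarrow> a \<bullet> u" for u
  proof (rule tendstoI)
    fix \<epsilon> :: real assume "0 < \<epsilon>"
    show "\<forall>\<^sub>F k in sequentially. dist (y k \<bullet> u) (a \<bullet> u) < \<epsilon>"
      using one_side[OF \<open>0 < \<epsilon>\<close>, of u] one_side[OF \<open>0 < \<epsilon>\<close>, of "- u"]
      by eventually_elim (simp add: dist_real_def inner_diff_left abs_less_iff)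
  qed
  then show ?thesis using a(1) unfolding weakly_converges_def by blast
qed

lemma nonexpansive_towards_Fix:
  assumes "nonexpansive R" and "z \<in> Fix R"
  shows "norm (R p - z) \<le> norm (p - z)"
proof -
  have "norm (R p - R z) \<le> norm (p - z)" using assms(1) by (simp add: nonexpansive_def)
  moreover have "R z = z" using assms(2) by (simp add: Fix_def)
  ultimately show ?thesis by simp
qed

lemma convex_combination_norm_sq:
  fixes a b :: "'a::real_inner"
  shows "(norm ((1 - \<mu>) *\<^sub>R a + \<mu> *\<^sub>R b))\<^sup>2
    = (1 - \<mu>) * (norm a)\<^sup>2 + \<mu> * (norm b)\<^sup>2 - \<mu> * (1 - \<mu>) * (norm (a - b))\<^sup>2"
  by (simp add: power2_norm_eq_inner inner_diff_left inner_diff_right inner_add_left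
      inner_add_right inner_commute algebra_simps)

text \<open>
  The decrease comes from the strong convexity of the squared norm alone; \<open>R\<close> contributes only that
  \<open>R p\<close> is no farther from \<open>z\<close> than \<open>p\<close> is.
\<close>

lemma relaxed_step_decrease:
  fixes R :: "'a::real_inner \<Rightarrow> 'a"
  assumes R: "nonexpansive R" and "z \<in> Fix R" and "0 \<le> \<mu>"
  shows "(norm ((1 - \<mu>) *\<^sub>R p + \<mu> *\<^sub>R R p - z))\<^sup>2
    \<le> (norm (p - z))\<^sup>2 - \<mu> * (1 - \<mu>) * (norm (p - R p))\<^sup>2"
proof -
  have eq: "(1 - \<mu>) *\<^sub>R p + \<mu> *\<^sub>R R p - z = (1 - \<mu>) *\<^sub>R (p - z) + \<mu> *\<^sub>R (R p - z)"
    by (simp add: algebra_simps)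
  have "\<mu> * (norm (R p - z))\<^sup>2 \<le> \<mu> * (norm (p - z))\<^sup>2"
    using assms(3) nonexpansive_towards_Fix[OF R assms(2)] by (simp add: mult_left_mono power_mono)
  then show ?thesis
    unfolding eq convex_combination_norm_sq by (simp add: algebra_simps)
qed

text \<open>
  The total decrease of the squared distance to a fixed point is bounded, whereas the residual
  \<open>norm (y\<^sub>k - R y\<^sub>k)\<close> is nonincreasing; a residual bounded below by \<open>\<delta>\<close> would make the total
  decrease at least \<open>\<delta>\<^sup>2 \<Sum> \<mu>\<^sub>k (1 - \<mu>\<^sub>k) = \<infinity>\<close>.
\<close>

lemma averaged_orbit_regular:
  fixes y :: "nat \<Rightarrow> 'a::real_inner"
  assumes R: "nonexpansive R" and z: "z \<in> Fix R"
    and \<mu>: "\<And>k. 0 \<le> \<mu> k \<and> \<mu> k \<le> 1"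
    and div: "filterlim (\<lambda>n. \<Sum>k<n. \<mu> k * (1 - \<mu> k)) at_top sequentially"
    and step: "\<And>k. y (Suc k) = (1 - \<mu> k) *\<^sub>R y k + \<mu> k *\<^sub>R R (y k)"
  shows "(\<lambda>k. norm (y k - R (y k))) \<longlonglongrightarrow> 0"
proof -
  let ?d = "\<lambda>k. norm (y k - R (y k))"
  have "?d (Suc k) \<le> ?d k" for k
  proof -
    have "y (Suc k) - R (y (Suc k)) = (1 - \<mu> k) *\<^sub>R (y k - R (y k)) + (R (y k) - R (y (Suc k)))"
      by (simp add: step algebra_simps)
    then have "?d (Suc k) \<le> norm ((1 - \<mu> k) *\<^sub>R (y k - R (y k))) + norm (R (y k) - R (y (Suc k)))"
      by (metis norm_triangle_ineq)
    also have "\<dots> \<le> (1 - \<mu> k) * ?d k + norm (y k - y (Suc k))"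
      using R \<mu>[of k] by (simp add: nonexpansive_def)
    also have "y k - y (Suc k) = \<mu> k *\<^sub>R (y k - R (y k))" by (simp add: step algebra_simps)
    finally have "?d (Suc k) \<le> (1 - \<mu> k) * ?d k + norm (\<mu> k *\<^sub>R (y k - R (y k)))" .
    then show ?thesis using \<mu>[of k] by (simp add: left_diff_distrib)
  qed
  then have dec: "?d n \<le> ?d k" if "k \<le> n" for k n
    using that by (rule lift_Suc_antimono_le)
  have total: "(\<Sum>k<n. \<mu> k * (1 - \<mu> k) * (?d k)\<^sup>2) \<le> (norm (y 0 - z))\<^sup>2 - (norm (y n - z))\<^sup>2" for n
  proof (induction n)
    case (Suc n)
    then show ?case
      using relaxed_step_decrease[OF R z, of "\<mu> n" "y n"] \<mu>[of n] by (simp add: step)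
  qed simp
  have small: "\<exists>k. ?d k < \<delta>" if "\<delta> > 0" for \<delta>
  proof (rule ccontr)
    assume "\<nexists>k. ?d k < \<delta>"
    then have low: "\<delta>\<^sup>2 \<le> (?d k)\<^sup>2" for k using that by (simp add: not_less power_mono)
    have "(\<Sum>k<n. \<mu> k * (1 - \<mu> k)) * \<delta>\<^sup>2 \<le> (norm (y 0 - z))\<^sup>2" for n
    proof -
      have "(\<Sum>k<n. \<mu> k * (1 - \<mu> k)) * \<delta>\<^sup>2 \<le> (\<Sum>k<n. \<mu> k * (1 - \<mu> k) * (?d k)\<^sup>2)"
        unfolding sum_distrib_right using \<mu> low by (intro sum_mono mult_left_mono) auto
      also have "\<dots> \<le> (norm (y 0 - z))\<^sup>2" using total[of n] zero_le_power2[of "norm (y n - z)"] by linarith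
      finally show ?thesis .
    qed
    then have "(\<Sum>k<n. \<mu> k * (1 - \<mu> k)) \<le> (norm (y 0 - z))\<^sup>2 / \<delta>\<^sup>2" for n
      using that by (simp add: pos_le_divide_eq)
    moreover have "\<forall>\<^sub>F n in sequentially. (norm (y 0 - z))\<^sup>2 / \<delta>\<^sup>2 < (\<Sum>k<n. \<mu> k * (1 - \<mu> k))"
      using div by (simp add: filterlim_at_top_dense)
    ultimately have "\<forall>\<^sub>F n::nat in sequentially. False"
      by (auto elim!: eventually_mono simp: not_less[symmetric])
    then show False by simp
  qed
  show ?thesis
  proof (rule LIMSEQ_I)
    fix \<delta> :: real assume "0 < \<delta>"
    then obtain k where "?d k < \<delta>" using small by blast
    then have "norm (?d n - 0) < \<delta>" if "k \<le> n" for n using dec[OF that] by simp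
    then show "\<exists>k. \<forall>n\<ge>k. norm (?d n - 0) < \<delta>" by blast
  qed
qed

lemma Krasnoselskii_Mann_weak:
  fixes y :: "nat \<Rightarrow> 'a::{real_inner, complete_space}"
  assumes R: "nonexpansive R" and fix_ne: "Fix R \<noteq> {}"
    and \<mu>: "\<And>k. 0 \<le> \<mu> k \<and> \<mu> k \<le> 1"
    and div: "filterlim (\<lambda>n. \<Sum>k<n. \<mu> k * (1 - \<mu> k)) at_top sequentially"
    and step: "\<And>k. y (Suc k) = (1 - \<mu> k) *\<^sub>R y k + \<mu> k *\<^sub>R R (y k)"
  shows "\<exists>a \<in> Fix R. weakly_converges y a"
proof (rule Fejer_weak_convergence[OF R fix_ne])
  show "norm (y (Suc k) - z) \<le> norm (y k - z)" if "z \<in> Fix R" for z k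
  proof (rule power2_le_imp_le)
    have "0 \<le> \<mu> k * (1 - \<mu> k) * (norm (y k - R (y k)))\<^sup>2" using \<mu>[of k] by simp
    then show "(norm (y (Suc k) - z))\<^sup>2 \<le> (norm (y k - z))\<^sup>2"
      using relaxed_step_decrease[OF R that, of "\<mu> k" "y k"] \<mu>[of k] unfolding step by linarith
  qed simp
  show "(\<lambda>k. norm (y k - R (y k))) \<longlonglongrightarrow> 0"
  proof -
    obtain z where z: "z \<in> Fix R" using fix_ne by blast
    show ?thesis by (rule averaged_orbit_regular[OF R z \<mu> div step])
  qed
qed

section \<open>Exact and inexact orbits of nonexpansive maps\<close>

primrec orbit :: "(nat \<Rightarrow> 'a \<Rightarrow> 'a) \<Rightarrow> 'a \<Rightarrow> nat \<Rightarrow> 'a" where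
  "orbit U a 0 = a"
| "orbit U a (Suc k) = U k (orbit U a k)"

lemma orbit_add: "orbit U a (k + n) = orbit (\<lambda>j. U (j + n)) (orbit U a n) k"
  by (induction k) simp_all

lemma orbit_nonexpansive:
  assumes "\<And>k. nonexpansive (U k)"
  shows "norm (orbit U a k - orbit U b k) \<le> norm (a - b)"
proof (induction k)
  case (Suc k)
  have "norm (orbit U a (Suc k) - orbit U b (Suc k)) \<le> norm (orbit U a k - orbit U b k)"
    using assms[of k] by (simp add: nonexpansive_def)
  with Suc show ?case by linarith
qed simp

text \<open>
  An error committed at one step is transported by nonexpansive maps afterwards and so never grows;
  the total deviation is at most the sum of the errors committed since time \<open>i\<close>.
\<close>

lemma inexact_orbit_near_exact:
  fixes x :: "nat \<Rightarrow> 'a::real_normed_vector"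
  assumes U: "\<And>k. nonexpansive (U k)"
    and err: "summable (\<lambda>k. norm (x (Suc k) - U k (x k)))"
  shows "norm (x (k + i) - orbit (\<lambda>j. U (j + i)) (x i) k)
    \<le> (\<Sum>j. norm (x (Suc (j + i)) - U (j + i) (x (j + i))))"
proof -
  let ?\<epsilon> = "\<lambda>j. norm (x (Suc (j + i)) - U (j + i) (x (j + i)))"
  let ?o = "orbit (\<lambda>j. U (j + i)) (x i)"
  have "norm (x (k + i) - ?o k) \<le> (\<Sum>j<k. ?\<epsilon> j)"
  proof (induction k)
    case (Suc k)
    have "norm (U (k + i) (x (k + i)) - U (k + i) (?o k)) \<le> norm (x (k + i) - ?o k)"
      using U by (simp add: nonexpansive_def)
    then show ?case
      using Suc norm_triangle_ineq[of "x (Suc (k + i)) - U (k + i) (x (k + i))"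
          "U (k + i) (x (k + i)) - U (k + i) (?o k)"] by simp
  qed simp
  also have "\<dots> \<le> (\<Sum>j. ?\<epsilon> j)"
    using summable_ignore_initial_segment[OF err, of i] by (intro sum_le_suminf) auto
  finally show ?thesis .
qed

text \<open>
  Testing the weak limits against the functional given by \<open>l - m\<close> itself produces \<open>(norm (l - m))\<^sup>2\<close>,
  and Cauchy-Schwarz bounds the terms of the sequence by \<open>\<rho> * norm (l - m)\<close>.
\<close>

lemma weak_limit_norm_le:
  fixes s t :: "nat \<Rightarrow> 'a::real_inner"
  assumes "weakly_converges s l" and "weakly_converges t m"
    and bound: "\<And>k. norm (s k - t k) \<le> \<rho>"
  shows "norm (l - m) \<le> \<rho>"
proof -
  have lim: "(\<lambda>k. (s k - t k) \<bullet> (l - m)) \<longlonglongrightarrow> (l - m) \<bullet> (l - m)"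
    using assms(1,2) unfolding weakly_converges_def inner_diff_left by (intro tendsto_diff) blast+
  have "(s k - t k) \<bullet> (l - m) \<le> \<rho> * norm (l - m)" for k
    by (rule order_trans[OF norm_cauchy_schwarz mult_right_mono[OF bound norm_ge_zero]])
  then have "(l - m) \<bullet> (l - m) \<le> \<rho> * norm (l - m)"
    by (intro LIMSEQ_le_const2[OF lim]) blast
  then have le: "norm (l - m) * norm (l - m) \<le> \<rho> * norm (l - m)"
    by (simp add: dot_square_norm power2_eq_square)
  have "0 \<le> \<rho>" using bound[of 0] norm_ge_zero order_trans by blast
  with le show ?thesis by (cases "l = m") auto
qed

lemma weakly_converges_shift:
  assumes "weakly_converges s l"
  shows "weakly_converges (\<lambda>k. s (k + n)) l"
  unfolding weakly_converges_def
proof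
  fix u
  have "(\<lambda>k. s k \<bullet> u) \<longlonglongrightarrow> l \<bullet> u" using assms by (simp add: weakly_converges_def)
  then show "(\<lambda>k. s (k + n) \<bullet> u) \<longlonglongrightarrow> l \<bullet> u" by (rule LIMSEQ_ignore_initial_segment)
qed

text \<open>
  The passage from the exact orbits to the inexact one, for an arbitrary measure of deviation: \<open>f\<close>
  will be a norm for strong convergence and a linear functional for weak convergence.
\<close>

lemma vanishing_by_approximation:
  fixes f :: "nat \<Rightarrow> real"
  assumes nonneg: "\<And>n. 0 \<le> f n"
    and approx: "\<And>i k. f (k + i) \<le> g i k + \<tau> i"
    and g: "\<And>i. g i \<longlonglongrightarrow> 0" and \<tau>: "\<tau> \<longlonglongrightarrow> 0"
  shows "f \<longlonglongrightarrow> 0"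
proof (rule tendstoI)
  fix \<epsilon> :: real assume "0 < \<epsilon>"
  then have "\<forall>\<^sub>F i in sequentially. \<tau> i < \<epsilon> / 2" by (intro order_tendstoD(2)[OF \<tau>]) simp
  then obtain i where i: "\<tau> i < \<epsilon> / 2" using eventually_happens' sequentially_bot by blast
  have "\<forall>\<^sub>F k in sequentially. g i k < \<epsilon> / 2"
    using \<open>0 < \<epsilon>\<close> by (intro order_tendstoD(2)[OF g]) simp
  then have "\<forall>\<^sub>F k in sequentially. dist (f (k + i)) 0 < \<epsilon>"
  proof eventually_elim
    case (elim k)
    then show ?case using i approx[of k i] nonneg[of "k + i"] by simp
  qed
  then show "\<forall>\<^sub>F n in sequentially. dist (f n) 0 < \<epsilon>"
    using eventually_sequentially_seg[of "\<lambda>n. dist (f n) 0 < \<epsilon>" i] by simp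
qed

text \<open>
  The exact orbits restarted from later and later points \<open>x\<^sub>i\<close> shadow \<open>x\<close> ever more closely, so their
  limits \<open>\<xi>\<^sub>i\<close> settle down, and \<open>x\<close> follows them.
\<close>

lemma inexact_orbit_limit:
  fixes x \<xi> :: "nat \<Rightarrow> 'a::{real_inner, complete_space}"
  assumes U: "\<And>k. nonexpansive (U k)"
    and err: "summable (\<lambda>k. norm (x (Suc k) - U k (x k)))"
    and weak: "\<And>i. weakly_converges (orbit (\<lambda>k. U (k + i)) (x i)) (\<xi> i)"
  shows "\<exists>\<xi>bar. \<xi> \<longlonglongrightarrow> \<xi>bar \<and> weakly_converges x \<xi>bar \<and>
    ((\<forall>i. orbit (\<lambda>k. U (k + i)) (x i) \<longlonglongrightarrow> \<xi> i) \<longrightarrow> x \<longlonglongrightarrow> \<xi>bar)"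
proof -
  define o' where "o' i = orbit (\<lambda>k. U (k + i)) (x i)" for i
  define \<tau> where "\<tau> i = (\<Sum>j. norm (x (Suc (j + i)) - U (j + i) (x (j + i))))" for i
  have near: "norm (x (k + i) - o' i k) \<le> \<tau> i" for i k
    unfolding o'_def \<tau>_def by (rule inexact_orbit_near_exact[OF U err])
  have \<tau>: "\<tau> \<longlonglongrightarrow> 0"
    unfolding \<tau>_def using suminf_exist_split2[OF err] by simp
  \<comment> \<open>from time \<open>n + i\<close> on, the orbits started at times \<open>i\<close> and \<open>n + i\<close> follow the same maps\<close>
  have \<xi>_near: "norm (\<xi> (n + i) - \<xi> i) \<le> \<tau> i" for n i
  proof (rule weak_limit_norm_le)
    show "weakly_converges (o' (n + i)) (\<xi> (n + i))" using weak by (simp add: o'_def)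
    show "weakly_converges (\<lambda>k. o' i (k + n)) (\<xi> i)"
      using weak by (intro weakly_converges_shift) (simp add: o'_def)
    fix k
    have "o' i (k + n) = orbit (\<lambda>k. U (k + (n + i))) (o' i n) k"
      by (simp add: o'_def orbit_add add.assoc)
    then have "norm (o' (n + i) k - o' i (k + n)) \<le> norm (x (n + i) - o' i n)"
      using orbit_nonexpansive[of "\<lambda>k. U (k + (n + i))", OF U] by (simp add: o'_def)
    then show "norm (o' (n + i) k - o' i (k + n)) \<le> \<tau> i" using near[of n i] by linarith
  qed
  have "Cauchy \<xi>"
  proof (rule CauchyI)
    fix \<epsilon> :: real assume "0 < \<epsilon>"
    then have "\<forall>\<^sub>F i in sequentially. \<tau> i < \<epsilon> / 2" by (intro order_tendstoD(2)[OF \<tau>]) simp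
    then obtain i where i: "\<tau> i < \<epsilon> / 2" using eventually_happens' sequentially_bot by blast
    have "norm (\<xi> m - \<xi> n) < \<epsilon>" if "i \<le> m" "i \<le> n" for m n
      using \<xi>_near[of "m - i" i] \<xi>_near[of "n - i" i] that i
        norm_triangle_ineq4[of "\<xi> m - \<xi> i" "\<xi> n - \<xi> i"] by simp
    then show "\<exists>M. \<forall>m\<ge>M. \<forall>n\<ge>M. norm (\<xi> m - \<xi> n) < \<epsilon>" by blast
  qed
  then obtain l where l: "\<xi> \<longlonglongrightarrow> l" using Cauchy_convergent convergent_def by blast
  have l_near: "norm (l - \<xi> i) \<le> \<tau> i" for i
  proof (rule LIMSEQ_le_const2)
    show "(\<lambda>n. norm (\<xi> (n + i) - \<xi> i)) \<longlonglongrightarrow> norm (l - \<xi> i)"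
      using l by (intro tendsto_intros LIMSEQ_ignore_initial_segment)
  qed (use \<xi>_near in blast)
  have split: "x (k + i) - l = (o' i k - \<xi> i) + ((x (k + i) - o' i k) - (l - \<xi> i))" for i k
    by simp
  have rest: "norm ((x (k + i) - o' i k) - (l - \<xi> i)) \<le> 2 * \<tau> i" for i k
    using norm_triangle_ineq4[of "x (k + i) - o' i k" "l - \<xi> i"] near[of k i] l_near[of i] by linarith
  have "weakly_converges x l"
    unfolding weakly_converges_def
  proof
    fix u
    have "(\<lambda>n. \<bar>(x n - l) \<bullet> u\<bar>) \<longlonglongrightarrow> 0"
    proof (rule vanishing_by_approximation)
      show "\<bar>(x (k + i) - l) \<bullet> u\<bar> \<le> \<bar>(o' i k - \<xi> i) \<bullet> u\<bar> + 2 * \<tau> i * norm u" for i k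
      proof -
        let ?r = "(x (k + i) - o' i k) - (l - \<xi> i)"
        have "(x (k + i) - l) \<bullet> u = (o' i k - \<xi> i) \<bullet> u + ?r \<bullet> u"
          by (subst split) (rule inner_add_left)
        moreover have "\<bar>?r \<bullet> u\<bar> \<le> 2 * \<tau> i * norm u"
          by (rule order_trans[OF Cauchy_Schwarz_ineq2 mult_right_mono[OF rest norm_ge_zero]])
        ultimately show ?thesis by linarith
      qed
      show "(\<lambda>k. \<bar>(o' i k - \<xi> i) \<bullet> u\<bar>) \<longlonglongrightarrow> 0" for i
        using weak[of i] unfolding weakly_converges_def o'_def inner_diff_left
        by (intro tendsto_rabs_zero LIM_zero) blast
      show "(\<lambda>i. 2 * \<tau> i * norm u) \<longlonglongrightarrow> 0"
        by (intro tendsto_mult_left_zero tendsto_mult_right_zero \<tau>)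
    qed simp
    then show "(\<lambda>n. x n \<bullet> u) \<longlonglongrightarrow> l \<bullet> u"
      by (simp add: tendsto_rabs_zero_iff inner_diff_left LIM_zero_iff)
  qed
  moreover have "x \<longlonglongrightarrow> l" if strong: "\<forall>i. orbit (\<lambda>k. U (k + i)) (x i) \<longlonglongrightarrow> \<xi> i"
  proof -
    have "(\<lambda>n. norm (x n - l)) \<longlonglongrightarrow> 0"
    proof (rule vanishing_by_approximation)
      show "norm (x (k + i) - l) \<le> norm (o' i k - \<xi> i) + 2 * \<tau> i" for i k
        by (subst split) (rule norm_triangle_le, simp only: add_left_mono rest)
      show "(\<lambda>k. norm (o' i k - \<xi> i)) \<longlonglongrightarrow> 0" for i
        using strong by (intro tendsto_norm_zero LIM_zero) (simp add: o'_def)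
      show "(\<lambda>i. 2 * \<tau> i) \<longlonglongrightarrow> 0" by (intro tendsto_mult_right_zero \<tau>)
    qed simp
    then show ?thesis by (simp add: tendsto_norm_zero_iff LIM_zero_iff)
  qed
  ultimately show ?thesis using l by blast
qed

section \<open>The averaged operator\<close>

lemma nonexpansive_convex_combination:
  assumes R: "nonexpansive R" and "0 \<le> \<mu>" "\<mu> \<le> 1"
  shows "nonexpansive (\<lambda>p. (1 - \<mu>) *\<^sub>R p + \<mu> *\<^sub>R R p)"
  unfolding nonexpansive_def
proof (intro allI)
  fix p q
  have "norm ((1 - \<mu>) *\<^sub>R p + \<mu> *\<^sub>R R p - ((1 - \<mu>) *\<^sub>R q + \<mu> *\<^sub>R R q))
      = norm ((1 - \<mu>) *\<^sub>R (p - q) + \<mu> *\<^sub>R (R p - R q))"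
    by (simp add: algebra_simps)
  also have "\<dots> \<le> (1 - \<mu>) * norm (p - q) + \<mu> * norm (R p - R q)"
    using assms(2,3) norm_triangle_ineq[of "(1 - \<mu>) *\<^sub>R (p - q)" "\<mu> *\<^sub>R (R p - R q)"] by simp
  also have "\<dots> \<le> (1 - \<mu>) * norm (p - q) + \<mu> * norm (p - q)"
    using R assms(2) by (simp add: nonexpansive_def mult_left_mono)
  finally show "norm ((1 - \<mu>) *\<^sub>R p + \<mu> *\<^sub>R R p - ((1 - \<mu>) *\<^sub>R q + \<mu> *\<^sub>R R q)) \<le> norm (p - q)"
    by (simp add: algebra_simps)
qed

lemma Fix_nonexpansive_limit:
  assumes R: "nonexpansive R" and "\<And>i. \<xi> i \<in> Fix R" and lim: "\<xi> \<longlonglongrightarrow> l"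
  shows "l \<in> Fix R"
proof -
  have "norm (\<xi> i - R l) \<le> norm (\<xi> i - l)" for i
    using nonexpansive_towards_Fix[OF R assms(2)] by (simp add: norm_minus_commute)
  then have "norm (l - R l) \<le> norm (l - l)"
    by (intro LIMSEQ_le[OF tendsto_norm[OF tendsto_diff[OF lim tendsto_const]]
          tendsto_norm[OF tendsto_diff[OF lim tendsto_const]]]) blast
  then show ?thesis by (simp add: Fix_def)
qed

lemma divergent_sum_shift:
  fixes c :: "nat \<Rightarrow> real"
  assumes "filterlim (\<lambda>n. \<Sum>k<n. c k) at_top sequentially"
  shows "filterlim (\<lambda>n. \<Sum>k<n. c (k + i)) at_top sequentially"
proof -
  have "filterlim (\<lambda>n. \<Sum>k<n + i. c k) at_top sequentially"
    by (rule filterlim_compose[OF assms filterlim_add_const_nat_at_top])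
  then have "filterlim (\<lambda>n. - (\<Sum>k<i. c k) + (\<Sum>k<n + i. c k)) at_top sequentially"
    by (rule filterlim_tendsto_add_at_top[OF tendsto_const])
  moreover have "(\<Sum>k<n + i. c k) = (\<Sum>k<i. c k) + (\<Sum>k<n. c (k + i))" for n
    by (induction n) simp_all
  ultimately show ?thesis by simp
qed

theorem theorem4p7:
  fixes \<alpha> :: real
    and lam \<eta> :: "nat \<Rightarrow> real"
    and T :: "'a::{real_inner, complete_space} \<Rightarrow> 'a"
    and Tk :: "nat \<Rightarrow> 'a \<Rightarrow> 'a"
    and e x :: "nat \<Rightarrow> 'a"
  assumes "0 < \<alpha>" and "\<alpha> \<le> 1"
    and "\<And>k. 0 < lam k \<and> lam k \<le> 1 / \<alpha>"
    and "averaged \<alpha> T" and "Fix T \<noteq> {}"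
    and "\<And>k. 0 \<le> \<eta> k"
    and "summable (\<lambda>k. \<eta> k * norm (e k))"
    and "\<And>k. x (Suc k) = (1 - lam k) *\<^sub>R x k + lam k *\<^sub>R Tk k (x k) + \<eta> k *\<^sub>R e k"
    and "summable (\<lambda>k. lam k * norm (Tk k (x k) - T (x k)))"
  shows
    "(\<forall>(\<xi>s :: nat \<Rightarrow> nat \<Rightarrow> 'a) (\<xi> :: nat \<Rightarrow> 'a).
        (\<forall>i. \<xi>s i 0 = x i) \<longrightarrow>
        (\<forall>i k. \<xi>s i (Suc k) =
           (1 - lam (k + i)) *\<^sub>R \<xi>s i k + lam (k + i) *\<^sub>R T (\<xi>s i k)) \<longrightarrow>
        (\<forall>i. weakly_converges (\<xi>s i) (\<xi> i)) \<longrightarrow>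
        (\<exists>\<xi>bar. \<xi> \<longlonglongrightarrow> \<xi>bar \<and>
           weakly_converges x \<xi>bar \<and>
           ((\<forall>i. \<xi>s i \<longlonglongrightarrow> \<xi> i) \<longrightarrow> x \<longlonglongrightarrow> \<xi>bar)))
     \<and>
     (filterlim (\<lambda>n. \<Sum>k<n. lam k * (1 / \<alpha> - lam k)) at_top sequentially \<longrightarrow>
        (\<exists>xbar \<in> Fix T. weakly_converges x xbar))"
proof -
  obtain R where R: "nonexpansive R" and T: "\<And>p. T p = (1 - \<alpha>) *\<^sub>R p + \<alpha> *\<^sub>R R p"
    using assms(4) unfolding averaged_def by blast
  define \<mu> where "\<mu> k = \<alpha> * lam k" for k
  define U where "U k p = (1 - lam k) *\<^sub>R p + lam k *\<^sub>R T p" for k p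
  have \<mu>: "0 \<le> \<mu> k \<and> \<mu> k \<le> 1" for k
    using assms(1) assms(3)[of k] by (simp add: \<mu>_def pos_le_divide_eq mult.commute)
  have U_R: "U k = (\<lambda>p. (1 - \<mu> k) *\<^sub>R p + \<mu> k *\<^sub>R R p)" for k
    by (simp add: fun_eq_iff U_def T \<mu>_def algebra_simps)
  have U: "nonexpansive (U k)" for k
    unfolding U_R using \<mu>[of k] by (intro nonexpansive_convex_combination[OF R]) auto
  have "T p - p = \<alpha> *\<^sub>R (R p - p)" for p by (simp add: T algebra_simps)
  then have Fix_R: "Fix R = Fix T"
    using assms(1) unfolding Fix_def by (subst (1 2) eq_iff_diff_eq_0) simp
  have err: "summable (\<lambda>k. norm (x (Suc k) - U k (x k)))"
  proof (rule summable_comparison_test')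
    show "summable (\<lambda>k. lam k * norm (Tk k (x k) - T (x k)) + \<eta> k * norm (e k))"
      by (rule summable_add[OF assms(9,7)])
    fix k
    have "x (Suc k) - U k (x k) = lam k *\<^sub>R (Tk k (x k) - T (x k)) + \<eta> k *\<^sub>R e k"
      by (simp add: assms(8) U_def algebra_simps)
    then have "norm (x (Suc k) - U k (x k))
        \<le> norm (lam k *\<^sub>R (Tk k (x k) - T (x k))) + norm (\<eta> k *\<^sub>R e k)"
      by (simp only: norm_triangle_ineq)
    then show "norm (norm (x (Suc k) - U k (x k)))
        \<le> lam k * norm (Tk k (x k) - T (x k)) + \<eta> k * norm (e k)"
      using assms(3)[of k] assms(6)[of k] by simp
  qed
  show ?thesis
  proof (intro conjI allI impI)
    fix \<xi>s \<xi>
    assume start: "\<forall>i. \<xi>s i 0 = x i"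
      and step: "\<forall>i k. \<xi>s i (Suc k) = (1 - lam (k + i)) *\<^sub>R \<xi>s i k + lam (k + i) *\<^sub>R T (\<xi>s i k)"
      and weak: "\<forall>i. weakly_converges (\<xi>s i) (\<xi> i)"
    have "\<xi>s i k = orbit (\<lambda>k. U (k + i)) (x i) k" for i k
      by (induction k) (simp_all add: start step U_def)
    then have "orbit (\<lambda>k. U (k + i)) (x i) = \<xi>s i" for i by (simp add: fun_eq_iff)
    then show "\<exists>\<xi>bar. \<xi> \<longlonglongrightarrow> \<xi>bar \<and> weakly_converges x \<xi>bar \<and> ((\<forall>i. \<xi>s i \<longlonglongrightarrow> \<xi> i) \<longrightarrow> x \<longlonglongrightarrow> \<xi>bar)"
      using inexact_orbit_limit[OF U err, of \<xi>] weak by simp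
  next
    assume div: "filterlim (\<lambda>n. \<Sum>k<n. lam k * (1 / \<alpha> - lam k)) at_top sequentially"
    have "\<mu> k * (1 - \<mu> k) = \<alpha>\<^sup>2 * (lam k * (1 / \<alpha> - lam k))" for k
      using assms(1) by (simp add: \<mu>_def power2_eq_square field_simps)
    then have "(\<Sum>k<n. \<mu> k * (1 - \<mu> k)) = \<alpha>\<^sup>2 * (\<Sum>k<n. lam k * (1 / \<alpha> - lam k))" for n
      by (simp add: sum_distrib_left)
    moreover have "filterlim (\<lambda>n. \<alpha>\<^sup>2 * (\<Sum>k<n. lam k * (1 / \<alpha> - lam k))) at_top sequentially"
      using assms(1) by (intro filterlim_tendsto_pos_mult_at_top[OF tendsto_const _ div]) simp
    ultimately have \<mu>_div: "filterlim (\<lambda>n. \<Sum>k<n. \<mu> k * (1 - \<mu> k)) at_top sequentially"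
      by simp
    have "\<exists>a \<in> Fix R. weakly_converges (orbit (\<lambda>k. U (k + i)) (x i)) a" for i
      by (rule Krasnoselskii_Mann_weak[OF R _ _ divergent_sum_shift[OF \<mu>_div, of i]])
        (use assms(5) \<mu> in \<open>simp_all add: Fix_R U_R\<close>)
    then obtain \<xi> where \<xi>: "\<And>i. \<xi> i \<in> Fix R"
      "\<And>i. weakly_converges (orbit (\<lambda>k. U (k + i)) (x i)) (\<xi> i)" by metis
    obtain l where l: "\<xi> \<longlonglongrightarrow> l" "weakly_converges x l"
      using inexact_orbit_limit[OF U err \<xi>(2)] by blast
    then show "\<exists>xbar \<in> Fix T. weakly_converges x xbar"
      using Fix_nonexpansive_limit[OF R \<xi>(1) l(1)] Fix_R by blast
  qed
qed

end
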